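(* Let $m\ge 1$ and let $\tau=m\tau'm\in[m]^l$ be a subword pattern, where the word $\tau'$ (of length $l-2$) does not contain the letter $m$. Then for every $k\ge m$, \[ F_\tau(x,y;k)=\frac{1}{1-(m-1)x-x\sum_{j=m-1}^{k-1}\frac{1}{1+\binom{j}{m-1}x^{l-1}(1-y)}}. \]
   Context: $[k]=\{1,\dots,k\}$ and $[k]^n$ is the set of words of length $n$ over $[k]$. A subword pattern is a word $\tau\in[m]^l$ containing every letter of $[m]$. An occurrence of $\tau$ in $\sigma=\sigma_1\cdots\sigma_n$ is an index $i$ such that the consecutive factor $\sigma_i\cdots\sigma_{i+l-1}$ is order-isomorphic to $\tau$ (same relative order and same equalities among positions). $\sigma(\tau)$ is the number of occurrences, and $F_\tau(x,y;k)=\sum_{n\ge0}\sum_{\sigma\in[k]^n}x^ny^{\sigma(\tau)}$. *)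

theory Defs
  imports
    "HOL-Computational_Algebra.Formal_Power_Series"
    "HOL-Computational_Algebra.Polynomial_Factorial"
begin

definition words :: "nat \<Rightarrow> nat \<Rightarrow> nat list set" where
  "words k n = {\<sigma>. length \<sigma> = n \<and> set \<sigma> \<subseteq> {1..k}}"

definition subword_pattern :: "nat \<Rightarrow> nat \<Rightarrow> nat list \<Rightarrow> bool" where
  "subword_pattern m l \<tau> \<longleftrightarrow> \<tau> \<in> words m l \<and> (\<forall>a\<in>{1..m}. a \<in> set \<tau>)"

definition order_isomorphic :: "nat list \<Rightarrow> nat list \<Rightarrow> bool" where
  "order_isomorphic u v \<longleftrightarrow> length u = length v \<and>
     (\<forall>a < length u. \<forall>b < length u.
        (u ! a < u ! b \<longleftrightarrow> v ! a < v ! b) \<and> (u ! a = u ! b \<longleftrightarrow> v ! a = v ! b))"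

(* Positions are counted from 0; the bound makes the factor lie entirely inside the word. *)
definition occurrences :: "nat list \<Rightarrow> nat list \<Rightarrow> nat set" where
  "occurrences \<tau> \<sigma> =
     {i. i + length \<tau> \<le> length \<sigma> \<and> order_isomorphic (take (length \<tau>) (drop i \<sigma>)) \<tau>}"

definition num_occurrences :: "nat list \<Rightarrow> nat list \<Rightarrow> nat" where
  "num_occurrences \<tau> \<sigma> = card (occurrences \<tau> \<sigma>)"

(* The indeterminate y, as an element of the field Q(y) of rational functions. *)
definition Y :: "rat poly fract" where
  "Y = to_fract [:0, 1:]"

(* F_tau(x,y;k) as a formal power series in x (the library's fps_X). Its coefficients are
   polynomials in y, regarded as elements of Q(y) so that fps division is available. *)
definition F :: "nat list \<Rightarrow> nat \<Rightarrow> rat poly fract fps" where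
  "F \<tau> k = Abs_fps (\<lambda>n. \<Sum>\<sigma>\<in>words k n. Y ^ num_occurrences \<tau> \<sigma>)"

end

theory Submission
  imports Defs
begin

text \<open>
  Split a word over \<open>{1..k+1}\<close> at its first letter \<open>K = k + 1\<close>. An occurrence of \<open>m \<tau>' m\<close> that
  contains the letter \<open>K\<close> must consist of two consecutive letters \<open>K\<close> and a word order-isomorphic
  to \<open>\<tau>'\<close> between them, and there are \<open>k choose (m - 1)\<close> such words over \<open>{1..k}\<close>.
  With \<open>G = F \<tau> k\<close> and \<open>P\<close> the generating function of the occurrences in the words \<open>K w\<close>, this gives
  \<open>F \<tau> (k + 1) = G + x G P\<close> and \<open>P = G + x H P\<close>, where
  \<open>H = G - (k choose (m - 1)) x^(l-2) (1 - y)\<close>. Eliminating \<open>P\<close> yields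
  \<open>1 / F \<tau> (k + 1) = 1 / F \<tau> k - x / (1 + (k choose (m - 1)) x^(l-1) (1 - y))\<close>.
\<close>

unbundle fps_syntax

section \<open>Words over an alphabet and their weighted generating functions\<close>

lemma finite_words [simp]: "finite (words k n)"
  using finite_lists_length_eq[of "{1..k}" n] by (simp add: words_def conj_commute)

lemma words_0 [simp]: "words k 0 = {[]}"
  by (auto simp: words_def)

lemma words_Suc: "words k (Suc n) = (\<lambda>(a, w). a # w) ` ({1..k} \<times> words k n)"
  by (auto simp: words_def length_Suc_conv image_iff)

lemma sum_words_Suc:
  "(\<Sum>w\<in>words k (Suc n). f w) = (\<Sum>a\<in>{1..k}. \<Sum>w\<in>words k n. f (a # w))"
  unfolding words_Suc
  by (subst sum.reindex) (auto simp: inj_on_def sum.cartesian_product split_def)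

text \<open>A word containing \<open>Suc k\<close> is uniquely \<open>u @ Suc k # v\<close> with
  \<open>u\<close> over \<open>{1..k}\<close>; \<open>i\<close> is the length of \<open>u\<close>.
  Leaving \<open>f\<close> arbitrary lets the induction apply to
  \<open>\<lambda>w. f (a # w)\<close>.\<close>

lemma sum_words_split:
  fixes f :: "nat list \<Rightarrow> 'a :: comm_monoid_add"
  shows "(\<Sum>w\<in>words (Suc k) n. f w) = (\<Sum>w\<in>words k n. f w) +
    (\<Sum>i<n. \<Sum>u\<in>words k i. \<Sum>v\<in>words (Suc k) (n - Suc i). f (u @ Suc k # v))"
proof (induction n arbitrary: f)
  case (Suc n)
  have "(\<Sum>w\<in>words (Suc k) (Suc n). f w) =
      (\<Sum>a\<in>{1..k}. \<Sum>w\<in>words (Suc k) n. f (a # w)) + (\<Sum>w\<in>words (Suc k) n. f (Suc k # w))"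
    by (simp add: sum_words_Suc)
  \<comment> \<open>Prefixing \<open>a\<close> to a prefix of length \<open>i\<close> gives one of
    length \<open>Suc i\<close>; the missing case of an empty prefix is the sum over words starting
    with \<open>Suc k\<close>.\<close>
  also have "(\<Sum>a\<in>{1..k}. \<Sum>w\<in>words (Suc k) n. f (a # w)) =
      (\<Sum>w\<in>words k (Suc n). f w) +
      (\<Sum>i<n. \<Sum>u\<in>words k (Suc i). \<Sum>v\<in>words (Suc k) (n - Suc i). f (u @ Suc k # v))"
    unfolding Suc.IH sum_words_Suc sum.distrib append_Cons
    by (subst (2) sum.swap) simp
  finally show ?case
    by (simp only: sum.lessThan_Suc_shift) (simp add: ac_simps)
qed simp

text \<open>The weight is a parameter because three are used: for a word alone, after a largest
  letter, and between two largest letters.\<close>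

definition words_gf :: "nat \<Rightarrow> (nat list \<Rightarrow> 'a :: comm_ring_1) \<Rightarrow> 'a fps" where
  "words_gf k f = Abs_fps (\<lambda>n. \<Sum>w\<in>words k n. f w)"

lemma words_gf_cong:
  "(\<And>w. set w \<subseteq> {1..k} \<Longrightarrow> f w = g w) \<Longrightarrow> words_gf k f = words_gf k g"
  by (auto simp: words_gf_def words_def fps_eq_iff intro!: sum.cong)

text \<open>A multiplicative weight turns the sum over split points into a Cauchy product;
  \<open>fps_X\<close> accounts for the separating letter.\<close>

lemma words_gf_split:
  assumes "\<And>u v. set u \<subseteq> {1..k} \<Longrightarrow> set v \<subseteq> {1..Suc k} \<Longrightarrow> f (u @ Suc k # v) = g u * h v"
  shows "words_gf (Suc k) f = words_gf k f + fps_X * (words_gf k g * words_gf (Suc k) h)"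
proof (rule fps_ext)
  fix n
  have *: "(\<Sum>u\<in>words k i. \<Sum>v\<in>words (Suc k) j. f (u @ Suc k # v)) =
      (\<Sum>u\<in>words k i. g u) * (\<Sum>v\<in>words (Suc k) j. h v)" for i j
    unfolding sum_product by (intro sum.cong refl assms) (auto simp: words_def)
  show "words_gf (Suc k) f $ n =
      (words_gf k f + fps_X * (words_gf k g * words_gf (Suc k) h)) $ n"
  proof (cases n)
    case (Suc n')
    then show ?thesis
      by (simp only: fps_add_nth fps_X_mult_nth)
        (simp add: words_gf_def sum_words_split[of f] * fps_mult_nth lessThan_Suc_atMost
          atMost_atLeast0)
  qed (simp add: words_gf_def)
qed

section \<open>Order-isomorphic words as images under increasing maps\<close>

lemma order_isomorphic_length: "order_isomorphic u v \<Longrightarrow> length u = length v"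
  by (simp add: order_isomorphic_def)

lemma order_isomorphic_less_iff:
  "order_isomorphic u v \<Longrightarrow> a < length v \<Longrightarrow> b < length v \<Longrightarrow> u ! a < u ! b \<longleftrightarrow> v ! a < v ! b"
  by (simp add: order_isomorphic_def)

lemma order_isomorphic_eq_iff:
  "order_isomorphic u v \<Longrightarrow> a < length v \<Longrightarrow> b < length v \<Longrightarrow> u ! a = u ! b \<longleftrightarrow> v ! a = v ! b"
  by (simp add: order_isomorphic_def)

lemma order_isomorphic_map:
  assumes "strict_mono_on (set v) f"
  shows "order_isomorphic (map f v) v"
  using assms unfolding order_isomorphic_def
  by (auto simp: strict_mono_on_less strict_mono_on_eq)

lemma order_isomorphic_imp_map:
  assumes "order_isomorphic u v"
  obtains f where "strict_mono_on (set v) f" "u = map f v"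
proof -
  \<comment> \<open>\<open>p a\<close> is some position of \<open>a\<close> in \<open>v\<close>;
    which one is immaterial, since equal letters of \<open>v\<close> face equal letters of
    \<open>u\<close>.\<close>
  define p where "p a = (SOME i. i < length v \<and> v ! i = a)" for a
  have p: "p a < length v \<and> v ! p a = a" if "a \<in> set v" for a
    unfolding p_def by (rule someI_ex) (use that in \<open>simp add: in_set_conv_nth\<close>)
  define f where "f a = u ! p a" for a
  have "strict_mono_on (set v) f"
    by (rule strict_mono_onI) (use p order_isomorphic_less_iff[OF assms] in \<open>simp add: f_def\<close>)
  moreover have "u = map f v"
    by (rule nth_equalityI)
      (use p order_isomorphic_length[OF assms] order_isomorphic_eq_iff[OF assms]
        in \<open>simp_all add: f_def\<close>)
  ultimately show ?thesis by (rule that)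
qed

text \<open>Such a word is determined by its set of letters, and every \<open>r\<close>-subset of
  \<open>{1..k}\<close> arises, by substituting its increasing enumeration for \<open>1..r\<close>
  in \<open>v\<close>.\<close>

lemma card_order_isomorphic_words:
  assumes "set v = {1..r}"
  shows "card {u \<in> words k (length v). order_isomorphic u v} = k choose r"
proof -
  \<comment> \<open>Letters start at 1 but list positions at 0, hence \<open>a - 1\<close>.\<close>
  define f where "f S a = sorted_list_of_set S ! (a - 1)" for S :: "nat set" and a
  have image: "f S ` {1..r} = S" and mono: "strict_mono_on {1..r} (f S)"
    if "S \<subseteq> {1..k}" "card S = r" for S
  proof -
    have fin: "finite S" using that finite_subset by blast
    have len: "length (sorted_list_of_set S) = r" using that by simp
    have "f S ` {1..r} = (\<lambda>i. sorted_list_of_set S ! i) ` ((\<lambda>a. a - 1) ` {1..r})"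
      by (simp add: f_def image_image)
    also have "(\<lambda>a. a - 1) ` {1..r} = {..<r}"
      by (auto simp: image_iff intro!: bexI[of _ "Suc _"])
    also have "(\<lambda>i. sorted_list_of_set S ! i) ` {..<r} = set (sorted_list_of_set S)"
      using len by (auto simp: in_set_conv_nth)
    finally show "f S ` {1..r} = S" using fin by simp
    show "strict_mono_on {1..r} (f S)"
      by (rule strict_mono_onI, unfold f_def, rule sorted_wrt_nth_less[of "(<)"])
        (use len in \<open>auto simp del: length_sorted_list_of_set\<close>)
  qed
  have "bij_betw (\<lambda>S. map (f S) v) {S. S \<subseteq> {1..k} \<and> card S = r}
      {u \<in> words k (length v). order_isomorphic u v}"
  proof (rule bij_betw_byWitness[where f' = set])
    show "\<forall>S\<in>{S. S \<subseteq> {1..k} \<and> card S = r}. set (map (f S) v) = S"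
      using assms image by simp
    show "(\<lambda>S. map (f S) v) ` {S. S \<subseteq> {1..k} \<and> card S = r}
        \<subseteq> {u \<in> words k (length v). order_isomorphic u v}"
      using assms image mono by (simp add: words_def image_subset_iff order_isomorphic_map)
    have inverse: "card (set u) = r \<and> map (f (set u)) v = u" if u: "order_isomorphic u v" for u
    proof -
      obtain g where g: "strict_mono_on {1..r} g" "u = map g v"
        using order_isomorphic_imp_map[OF u] assms by metis
      have set_u: "set u = g ` {1..r}" using g assms by simp
      \<comment> \<open>The increasing list of the letters of \<open>u\<close> is unique, so
        \<open>g\<close> must agree with \<open>f (set u)\<close> on \<open>{1..r}\<close>.\<close>
      have sorted: "sorted_wrt (<) (map g [1..<Suc r])"
        using g(1) by (auto simp: sorted_wrt_map strict_mono_on_def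
            intro!: sorted_wrt_mono_rel[OF _ sorted_wrt_upt] simp del: upt_Suc)
      have "sorted_list_of_set (set u) = map g [1..<Suc r]"
        by (rule sorted_list_of_set.idem_if_sorted_distinct[of "map g [1..<Suc r]",
              unfolded set_map set_upt atLeastLessThanSuc_atLeastAtMost, folded set_u])
          (use sorted in \<open>simp_all only: strict_sorted_iff\<close>)
      then have "f (set u) a = g a" if "a \<in> {1..r}" for a
        using that by (cases a) (simp_all add: f_def del: upt_Suc)
      moreover have "card (set u) = r"
        using set_u strict_mono_on_imp_inj_on[OF g(1)] by (simp add: card_image)
      ultimately show ?thesis using g(2) assms by simp
    qed
    show "\<forall>u\<in>{u \<in> words k (length v). order_isomorphic u v}. map (f (set u)) v = u"
      using inverse by blast
    show "set ` {u \<in> words k (length v). order_isomorphic u v} \<subseteq> {S. S \<subseteq> {1..k} \<and> card S = r}"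
      using inverse by (auto simp: words_def)
  qed
  then have "card {u \<in> words k (length v). order_isomorphic u v} =
      card {S. S \<subseteq> {1..k} \<and> card S = r}"
    by (simp add: bij_betw_same_card)
  also have "\<dots> = k choose r"
    by (simp add: n_subsets)
  finally show ?thesis .
qed

section \<open>Counting occurrences letter by letter\<close>

lemma num_occurrences_Nil: "\<tau> \<noteq> [] \<Longrightarrow> num_occurrences \<tau> [] = 0"
  by (simp add: num_occurrences_def occurrences_def)

text \<open>Occurrences not at the front are shifted occurrences in \<open>w\<close>. On a word that
  is too short, \<open>take\<close> returns a list of the wrong length, so the test fails as it
  should.\<close>

lemma num_occurrences_Cons:
  assumes "\<tau> \<noteq> []"
  shows "num_occurrences \<tau> (a # w) =
    (if order_isomorphic (take (length \<tau>) (a # w)) \<tau> then 1 else 0) + num_occurrences \<tau> w"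
proof -
  let ?A = "if order_isomorphic (take (length \<tau>) (a # w)) \<tau> then {0 :: nat} else {}"
  have "occurrences \<tau> (a # w) = ?A \<union> Suc ` occurrences \<tau> w"
  proof (rule set_eqI)
    fix i
    show "i \<in> occurrences \<tau> (a # w) \<longleftrightarrow> i \<in> ?A \<union> Suc ` occurrences \<tau> w"
      by (cases i) (auto simp: occurrences_def image_iff dest!: order_isomorphic_length)
  qed
  moreover have "finite (occurrences \<tau> w)"
    by (rule finite_subset[of _ "{..length w}"]) (auto simp: occurrences_def)
  ultimately show ?thesis
    by (subst num_occurrences_def, simp add: card_Un_disjoint card_image num_occurrences_def)
qed

lemma num_occurrences_eq_0:
  "\<tau> \<noteq> [] \<Longrightarrow> length w < length \<tau> \<Longrightarrow> num_occurrences \<tau> w = 0"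
  by (simp add: num_occurrences_def occurrences_def)

section \<open>Occurrences of a pattern delimited by its largest letter\<close>

locale max_delimited_pattern =
  fixes m :: nat and \<tau>' :: "nat list"
  assumes set_inner: "set \<tau>' = {1..m - 1}" and m_pos: "m \<ge> 1"
begin

definition \<tau> :: "nat list" where "\<tau> = [m] @ \<tau>' @ [m]"

lemma \<tau>_nonempty [simp]: "\<tau> \<noteq> []"
  by (simp add: \<tau>_def)

lemma length_\<tau> [simp]: "length \<tau> = Suc (Suc (length \<tau>'))"
  by (simp add: \<tau>_def)

lemma \<tau>_nth_0 [simp]: "\<tau> ! 0 = m"
  by (simp add: \<tau>_def)

lemma \<tau>_nth_last [simp]: "\<tau> ! Suc (length \<tau>') = m"
  by (simp add: \<tau>_def nth_append)

lemma \<tau>_nth_Suc: "i < length \<tau>' \<Longrightarrow> \<tau> ! Suc i = \<tau>' ! i"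
  by (simp add: \<tau>_def nth_append)

lemma \<tau>_nth_Suc_less: "i < length \<tau>' \<Longrightarrow> \<tau> ! Suc i < m"
  using nth_mem[of i \<tau>'] set_inner m_pos by (auto simp: \<tau>_nth_Suc)

lemma \<tau>_nth_le: "i < length \<tau> \<Longrightarrow> \<tau> ! i \<le> m"
  using \<tau>_nth_Suc_less[of "i - 1"] by (cases i; cases "i = Suc (length \<tau>')") auto

lemma order_isomorphic_\<tau>_iff:
  assumes "set u \<subseteq> {1..k}" "length u = length \<tau>'" "k < K"
  shows "order_isomorphic (K # u @ [K]) \<tau> \<longleftrightarrow> order_isomorphic u \<tau>'"
proof
  assume iso: "order_isomorphic (K # u @ [K]) \<tau>"
  show "order_isomorphic u \<tau>'"
    unfolding order_isomorphic_def
  proof (intro conjI allI impI)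
    fix a b assume ab: "a < length u" "b < length u"
    show "u ! a < u ! b \<longleftrightarrow> \<tau>' ! a < \<tau>' ! b"
      using order_isomorphic_less_iff[OF iso, of "Suc a" "Suc b"] ab assms
      by (simp add: nth_append \<tau>_nth_Suc)
    show "u ! a = u ! b \<longleftrightarrow> \<tau>' ! a = \<tau>' ! b"
      using order_isomorphic_eq_iff[OF iso, of "Suc a" "Suc b"] ab assms
      by (simp add: nth_append \<tau>_nth_Suc)
  qed (use assms in simp)
next
  assume "order_isomorphic u \<tau>'"
  then obtain f where f: "strict_mono_on (set \<tau>') f" "u = map f \<tau>'"
    by (rule order_isomorphic_imp_map)
  have less: "a < m" "f a < K" if "a \<in> set \<tau>'" for a
    using that assms f(2) set_inner m_pos by auto force
  \<comment> \<open>Extending by \<open>m \<mapsto> K\<close> stays increasing: \<open>m\<close>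
    exceeds the letters of \<open>\<tau>'\<close>, and \<open>K\<close> exceeds their
    images.\<close>
  have "strict_mono_on (set \<tau>) (f(m := K))"
    using f(1) less by (auto simp: strict_mono_on_def \<tau>_def dest: less_asym)
  moreover have "K # u @ [K] = map (f(m := K)) \<tau>"
    using less f(2) by (auto simp: \<tau>_def)
  ultimately show "order_isomorphic (K # u @ [K]) \<tau>"
    by (simp only: order_isomorphic_map)
qed

text \<open>An occurrence starting in \<open>u\<close> cannot reach \<open>Suc k\<close>: its first
  letter would be smaller than a later one, while \<open>\<tau>\<close> starts with its
  maximum.\<close>

lemma num_occurrences_append:
  assumes "set u \<subseteq> {1..k}"
  shows "num_occurrences \<tau> (u @ Suc k # v) = num_occurrences \<tau> u + num_occurrences \<tau> (Suc k # v)"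
  using assms
proof (induction u)
  case (Cons a u)
  let ?w = "a # u @ Suc k # v"
  have "order_isomorphic (take (length \<tau>) ?w) \<tau> \<longleftrightarrow> order_isomorphic (take (length \<tau>) (a # u)) \<tau>"
  proof (cases "length \<tau> \<le> length (a # u)")
    case False
    have "\<not> order_isomorphic (take (length \<tau>) ?w) \<tau>"
    proof
      assume iso: "order_isomorphic (take (length \<tau>) ?w) \<tau>"
      have "take (length \<tau>) ?w ! 0 < take (length \<tau>) ?w ! Suc (length u)"
        using False Cons.prems by (simp add: nth_append)
      then have "m < \<tau> ! Suc (length u)"
        using order_isomorphic_less_iff[OF iso, of 0 "Suc (length u)"] False by simp
      then show False using \<tau>_nth_le[of "Suc (length u)"] False by simp
    qed
    moreover have "\<not> order_isomorphic (take (length \<tau>) (a # u)) \<tau>"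
      using False by (auto dest!: order_isomorphic_length)
    ultimately show ?thesis by blast
  qed simp
  then show ?case
    using Cons by (simp add: num_occurrences_Cons del: take_Suc_Cons length_\<tau>)
qed (simp add: num_occurrences_Nil)

text \<open>An occurrence at the front would have to end in a second \<open>Suc k\<close>.\<close>

lemma num_occurrences_max_Cons:
  assumes "set u \<subseteq> {1..k}"
  shows "num_occurrences \<tau> (Suc k # u) = num_occurrences \<tau> u"
proof -
  have "\<not> order_isomorphic (take (length \<tau>) (Suc k # u)) \<tau>"
  proof
    assume iso: "order_isomorphic (take (length \<tau>) (Suc k # u)) \<tau>"
    then have len: "length \<tau>' < length u"
      by (auto dest!: order_isomorphic_length)
    then have "u ! length \<tau>' = Suc k"
      using order_isomorphic_eq_iff[OF iso, of 0 "Suc (length \<tau>')"] by simp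
    then show False using assms nth_mem[OF len] by auto
  qed
  then show ?thesis by (simp add: num_occurrences_Cons del: take_Suc_Cons length_\<tau>)
qed

lemma num_occurrences_max_Cons_append:
  assumes "set u \<subseteq> {1..k}"
  shows "num_occurrences \<tau> (Suc k # u @ Suc k # v) =
    (num_occurrences \<tau> u + (if order_isomorphic u \<tau>' then 1 else 0)) +
    num_occurrences \<tau> (Suc k # v)"
proof -
  let ?w = "Suc k # u @ Suc k # v"
  have "order_isomorphic (take (length \<tau>) ?w) \<tau> \<longleftrightarrow> order_isomorphic u \<tau>'"
  proof (cases "length u = length \<tau>'")
    case True
    then show ?thesis using order_isomorphic_\<tau>_iff[OF assms True, of "Suc k"] by simp
  next
    case False
    have "\<not> order_isomorphic (take (length \<tau>) ?w) \<tau>"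
    proof
      assume iso: "order_isomorphic (take (length \<tau>) ?w) \<tau>"
      show False
      \<comment> \<open>Either the factor ends inside \<open>u\<close>, where its last letter is not
        \<open>Suc k\<close>, or the second \<open>Suc k\<close> falls strictly inside it, where
        \<open>\<tau>\<close> has only letters below \<open>m\<close>.\<close>
      proof (cases "length \<tau>' < length u")
        case True
        then have "u ! length \<tau>' = Suc k"
          using order_isomorphic_eq_iff[OF iso, of 0 "Suc (length \<tau>')"]
          by (simp add: nth_append)
        then show False using assms nth_mem[OF True] by auto
      next
        case inner: False
        then have "\<tau> ! Suc (length u) = m"
          using order_isomorphic_eq_iff[OF iso, of 0 "Suc (length u)"] False
          by (simp add: nth_append)
        then show False using \<tau>_nth_Suc_less[of "length u"] inner False by simp
      qed
    qed
    then show ?thesis using False order_isomorphic_length by blast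
  qed
  then show ?thesis
    using num_occurrences_append[OF assms, of v]
    by (simp add: num_occurrences_Cons[of _ "Suc k" "u @ _"] del: take_Suc_Cons length_\<tau>)
qed

section \<open>Recurrence in the alphabet size and its solution\<close>

lemma F_eq_words_gf: "F \<tau> k = words_gf k (\<lambda>w. Y ^ num_occurrences \<tau> w)"
  by (simp add: F_def words_gf_def)

lemma F_0: "F \<tau> 0 = 1"
proof (rule fps_ext)
  fix n
  have "words 0 (Suc i) = {}" for i by (auto simp: words_def)
  then show "F \<tau> 0 $ n = 1 $ n"
    by (cases n) (simp_all add: F_def num_occurrences_Nil)
qed

text \<open>The denominator of the summand with \<open>j = k\<close> in the final formula; the
  exponent is \<open>l - 1\<close>.\<close>

definition step_factor :: "nat \<Rightarrow> rat poly fract fps" where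
  "step_factor k = 1 + of_nat (k choose (m - 1)) * fps_X ^ (Suc (length \<tau>')) * (1 - fps_const Y)"

text \<open>This is the series \<open>H\<close>. A word order-isomorphic to \<open>\<tau>'\<close>
  is too short to contain \<open>\<tau>\<close>, so its weight changes from \<open>1\<close> to
  \<open>Y\<close>, a correction of \<open>Y - 1\<close> for each such word.\<close>

lemma words_gf_inner:
  "words_gf k (\<lambda>u. Y ^ (num_occurrences \<tau> u + (if order_isomorphic u \<tau>' then 1 else 0))) =
    F \<tau> k - of_nat (k choose (m - 1)) * fps_X ^ length \<tau>' * (1 - fps_const Y)"
proof (rule fps_ext)
  fix n
  let ?iso = "\<lambda>u. order_isomorphic u \<tau>'"
  have "Y ^ (num_occurrences \<tau> u + (if ?iso u then 1 else 0)) =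
      Y ^ num_occurrences \<tau> u + (if ?iso u then Y - 1 else 0)" for u
    using num_occurrences_eq_0[OF \<tau>_nonempty, of u] order_isomorphic_length[of u \<tau>'] by auto
  then have "words_gf k (\<lambda>u. Y ^ (num_occurrences \<tau> u + (if ?iso u then 1 else 0))) $ n =
      F \<tau> k $ n + (\<Sum>u\<in>words k n. if ?iso u then Y - 1 else 0)"
    by (simp add: words_gf_def F_def sum.distrib)
  also have "(\<Sum>u\<in>words k n. if ?iso u then Y - 1 else 0) =
      of_nat (card {u \<in> words k n. ?iso u}) * (Y - 1)"
    by (simp flip: sum.inter_filter)
  also have "card {u \<in> words k n. ?iso u} = (if n = length \<tau>' then k choose (m - 1) else 0)"
  proof (cases "n = length \<tau>'")
    case False
    then have "{u \<in> words k n. ?iso u} = {}"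
      by (auto simp: words_def dest: order_isomorphic_length)
    then show ?thesis using False by simp
  qed (simp add: card_order_isomorphic_words[OF set_inner])
  also have "of_nat \<dots> * (Y - 1) =
      - (of_nat (k choose (m - 1)) * fps_X ^ length \<tau>' * (1 - fps_const Y)) $ n"
  proof -
    have "of_nat (k choose (m - 1)) * fps_X ^ length \<tau>' * (1 - fps_const Y) =
        fps_const (of_nat (k choose (m - 1)) * (1 - Y)) * fps_X ^ length \<tau>'"
      by (simp add: fps_of_nat[symmetric] mult_ac flip: fps_const_mult fps_const_sub)
    then show ?thesis by (simp add: fps_X_power_nth algebra_simps)
  qed
  finally show "words_gf k (\<lambda>u. Y ^ (num_occurrences \<tau> u + (if ?iso u then 1 else 0))) $ n =
      (F \<tau> k - of_nat (k choose (m - 1)) * fps_X ^ length \<tau>' * (1 - fps_const Y)) $ n"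
    by simp
qed

text \<open>Eliminates \<open>P\<close> from the two splitting equations, in cross-multiplied form
  to avoid division of series.\<close>

lemma F_Suc: "F \<tau> (Suc k) * (step_factor k - fps_X * F \<tau> k) = F \<tau> k * step_factor k"
proof -
  define P where "P = words_gf (Suc k) (\<lambda>w. Y ^ num_occurrences \<tau> (Suc k # w))"
  define c where "c = of_nat (k choose (m - 1)) * fps_X ^ length \<tau>' * (1 - fps_const Y)"
  have F: "F \<tau> (Suc k) = F \<tau> k + fps_X * (F \<tau> k * P)"
    unfolding F_eq_words_gf P_def
    by (rule words_gf_split) (simp add: num_occurrences_append power_add)
  \<comment> \<open>After the leading \<open>Suc k\<close>, the part before the next
    \<open>Suc k\<close> lies between two largest letters and so carries the weight of
    \<open>H\<close>.\<close>
  have "P = words_gf k (\<lambda>w. Y ^ num_occurrences \<tau> (Suc k # w)) + fps_X * ((F \<tau> k - c) * P)"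
    unfolding c_def words_gf_inner[symmetric] P_def
    by (rule words_gf_split) (simp only: num_occurrences_max_Cons_append power_add)
  also have "words_gf k (\<lambda>w. Y ^ num_occurrences \<tau> (Suc k # w)) = F \<tau> k"
    unfolding F_eq_words_gf by (rule words_gf_cong) (simp add: num_occurrences_max_Cons)
  finally have P: "P = F \<tau> k + fps_X * ((F \<tau> k - c) * P)" .
  have q: "step_factor k = 1 + fps_X * c"
    by (simp add: step_factor_def c_def mult_ac)
  have "P * (step_factor k - fps_X * F \<tau> k) = F \<tau> k"
    using P unfolding q by (simp add: algebra_simps)
  \<comment> \<open>The two terms in \<open>fps_X * (F \<tau> k * F \<tau> k)\<close>
    cancel.\<close>
  then have "F \<tau> (Suc k) * (step_factor k - fps_X * F \<tau> k) =
      F \<tau> k * (step_factor k - fps_X * F \<tau> k) + fps_X * (F \<tau> k * F \<tau> k)"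
    unfolding F by (simp add: distrib_right mult.assoc)
  then show ?thesis by (simp add: algebra_simps)
qed

lemma step_factor_inverse: "step_factor k * inverse (step_factor k) = 1"
  by (rule inverse_mult_eq_1') (simp add: step_factor_def)

text \<open>Each step subtracts \<open>fps_X * inverse (step_factor k)\<close> from the reciprocal
  of \<open>F \<tau> k\<close>, starting from \<open>F \<tau> 0 = 1\<close>.\<close>

lemma F_mult_denominator: "F \<tau> k * (1 - fps_X * (\<Sum>j<k. inverse (step_factor j))) = 1"
proof (induction k)
  case (Suc k)
  define D where "D = 1 - fps_X * (\<Sum>j<k. inverse (step_factor j))"
  let ?q = "step_factor k" and ?I = "inverse (step_factor k)"
  have "F \<tau> (Suc k) * (1 - fps_X * (\<Sum>j<Suc k. inverse (step_factor j))) =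
      F \<tau> (Suc k) * (D - fps_X * ?I)"
    by (simp add: D_def algebra_simps)
  \<comment> \<open>Inserting \<open>?q * ?I = 1\<close> and \<open>F \<tau> k * D = 1\<close>
    exposes the factor \<open>?q - fps_X * F \<tau> k\<close> of the recurrence.\<close>
  also have "\<dots> = F \<tau> (Suc k) * (D * (?q * ?I) - fps_X * (F \<tau> k * D) * ?I)"
    using Suc.IH by (simp add: step_factor_inverse flip: D_def)
  also have "\<dots> = (F \<tau> (Suc k) * (?q - fps_X * F \<tau> k)) * D * ?I"
    by (simp add: algebra_simps)
  also have "\<dots> = (F \<tau> k * D) * (?q * ?I)"
    unfolding F_Suc by (simp only: mult_ac)
  also have "\<dots> = 1"
    using Suc.IH by (simp add: step_factor_inverse flip: D_def)
  finally show ?case .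
qed (simp add: F_0)

end

theorem theorem2p7:
  fixes m l k :: nat and \<tau> \<tau>' :: "nat list"
  assumes "m \<ge> 1"
    and "subword_pattern m l \<tau>"
    and "\<tau> = [m] @ \<tau>' @ [m]"
    and "m \<notin> set \<tau>'"
    and "k \<ge> m"
  shows "F \<tau> k =
    1 / (1 - of_nat (m - 1) * fps_X
           - fps_X * (\<Sum>j = m - 1..k - 1.
               1 / (1 + of_nat (j choose (m - 1)) * fps_X ^ (l - 1) * (1 - fps_const Y))))"
proof -
  have sub: "set \<tau>' \<subseteq> {1..m}" and sup: "{1..m} \<subseteq> insert m (set \<tau>')"
    and l: "l = Suc (Suc (length \<tau>'))"
    using assms(2,3) by (auto simp: subword_pattern_def words_def)
  have "set \<tau>' = {1..m} - {m}"
    using sub sup assms(4) by blast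
  also have "\<dots> = {1..m - 1}" by auto
  finally interpret max_delimited_pattern m \<tau>'
    using assms(1) by unfold_locales
  have \<tau>: "max_delimited_pattern.\<tau> m \<tau>' = \<tau>"
    using assms(3) by (simp add: \<tau>_def)
  let ?D = "1 - fps_X * (\<Sum>j<k. inverse (step_factor j))"
  have "(\<Sum>j<k. inverse (step_factor j)) =
      (\<Sum>j<m - 1. inverse (step_factor j)) + (\<Sum>j = m - 1..k - 1. inverse (step_factor j))"
    using assms(1,5)
    by (subst sum.union_disjoint[symmetric]) (auto intro!: sum.cong)
  \<comment> \<open>For \<open>j < m - 1\<close> the binomial coefficient vanishes and the factor is
    \<open>1\<close>; this is the source of the term \<open>of_nat (m - 1) * fps_X\<close>.\<close>
  also have "(\<Sum>j<m - 1. inverse (step_factor j)) = of_nat (m - 1)"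
    by (simp add: step_factor_def binomial_eq_0)
  finally have D: "?D = 1 - of_nat (m - 1) * fps_X -
      fps_X * (\<Sum>j = m - 1..k - 1. 1 / step_factor j)"
    by (simp add: algebra_simps fps_divide_unit step_factor_def)
  have "F \<tau> k = inverse ?D"
    using fps_inverse_unique[of ?D "F \<tau> k"] F_mult_denominator[of k] by (simp add: \<tau> mult.commute)
  also have "\<dots> = 1 / ?D"
    by (simp add: fps_divide_unit)
  finally show ?thesis
    unfolding D by (simp add: step_factor_def l)
qed

end
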